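(* Let $u_i^j$ and $U_i^j$ be the solutions, respectively, of $$u_i^{j+1}-\frac{\tau}{2}\left[c_l\,L_hu_i^{j+1}+c_r\,R_hu_i^{j+1}\right]=u_i^j+\frac{\tau}{2}\left[c_l\,L_hu_i^{j}+c_r\,R_hu_i^{j}\right]+\tau f_i^{j+\frac12}+O(\tau^3+\tau h^3)$$ (satisfied by the values $u_i^j$ of the exact solution of the tempered fractional diffusion problem at $(x_i,t_j)$) and of the numerical scheme for that problem $$U_i^{j+1}-\frac{\tau}{2}\left[c_l\,L_hU_i^{j+1}+c_r\,R_hU_i^{j+1}\right]=U_i^j+\frac{\tau}{2}\left[c_l\,L_hU_i^{j}+c_r\,R_hU_i^{j}\right]+\tau F_i^{j+\frac12}.$$ Put $e_i^j=u_i^j-U_i^j$, $i=1,\dots,M-1$, and $E^j=(e_1^j,\dots,e_{M-1}^j)^T$, $j=1,\dots,N$. Then, for $1<\alpha<2$, if the function $$f(\alpha,\lambda;x)=\sum_{k=0}^{M-1}g_{k,\lambda}\cos((k-1)x)-\phi(\lambda)$$ satisfies $f(\alpha,\lambda;x)<0$, one has, with a constant $c$, $$\|E^j\|_h\le c\,(\tau^2+h^3),\qquad 1\le j\le N-1.$$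
   Context: The tempered fractional diffusion problem is $\partial_tu=c_l\,{}_a\mathfrak{D}_x^{\alpha,\lambda}u+c_r\,{}_x\mathfrak{D}_b^{\alpha,\lambda}u+f(x,t)$ on $(a,b)\times(0,T)$, with $\lambda\ge0$, initial value $u(x,0)=S(x)$ and boundary values $u(a,t)=\Phi_l(t)$, $u(b,t)=\Phi_r(t)$. Here $c_l,c_r$ are constants with $c_l+c_r\neq0$; if $c_l\ne0$ then $\Phi_l\equiv0$, and if $c_r\ne0$ then $\Phi_r\equiv0$. The operators are $${}_a\mathfrak{D}_x^{\alpha,\lambda}u=e^{-\lambda x}{}_aD_x^\alpha(e^{\lambda x}u)-\lambda^\alpha u,\qquad {}_x\mathfrak{D}_b^{\alpha,\lambda}u=e^{\lambda x}{}_xD_b^\alpha(e^{-\lambda x}u)-\lambda^\alpha u,$$ with ${}_aD_x^\alpha,{}_xD_b^\alpha$ the left and right Riemann--Liouville derivatives of order $\alpha$. Grid: $x_i=a+ih$, $0\le i\le M$, $h=(b-a)/M$; $t_j=j\tau$, $0\le j\le N$, $\tau=T/N$. Also $f_i^{j}=f(x_i,t_j)$, $f_i^{j+\frac12}=f(x_i,t_{j+\frac12})$ and $F_i^{j+\frac12}=\frac12(f_i^j+f_i^{j+1})$. $\|\cdot\|_h$ is the discrete $L^2$ norm, $\|E\|_h=\left(h\sum_{i=1}^{M-1}e_i^2\right)^{1/2}$. Let $\omega_k^{(\alpha)}=(-1)^k\binom{\alpha}{k}$, $k\ge0$. Given a real parameter $\gamma_4$, set $$\gamma_1=\tfrac{\alpha^2}{8}+\tfrac{5}{24}\alpha-\gamma_4,\quad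 \gamma_2=-\tfrac{\alpha^2}{4}+\tfrac{1}{12}\alpha+1+3\gamma_4,\quad \gamma_3=\tfrac{\alpha^2}{8}-\tfrac{7}{24}\alpha-3\gamma_4 .$$ The weights are $$g_{0,\lambda}=\gamma_1\omega_0^{(\alpha)}e^{h\lambda},\quad g_{1,\lambda}=\gamma_1\omega_1^{(\alpha)}+\gamma_2\omega_0^{(\alpha)},\quad g_{2,\lambda}=\left(\gamma_1\omega_2^{(\alpha)}+\gamma_2\omega_1^{(\alpha)}+\gamma_3\omega_0^{(\alpha)}\right)e^{-h\lambda},$$ $$g_{k,\lambda}=\left(\gamma_1\omega_k^{(\alpha)}+\gamma_2\omega_{k-1}^{(\alpha)}+\gamma_3\omega_{k-2}^{(\alpha)}+\gamma_4\omega_{k-3}^{(\alpha)}\right)e^{-(k-1)h\lambda}\quad(k\ge3),$$ and $\phi(\lambda)=\left(\gamma_1e^{h\lambda}+\gamma_2+\gamma_3e^{-h\lambda}+\gamma_4e^{-2h\lambda}\right)(1-e^{-h\lambda})^\alpha$. The third-order tempered weighted and shifted Grünwald difference operators act on a grid function $(v_i)_{0\le i\le M}$, for $1\le i\le M-1$, by $$L_hv_i=\frac1{h^\alpha}\left(\sum_{k=0}^{i+1}g_{k,\lambda}v_{i-k+1}-\phi(\lambda)v_i\right),\qquad R_hv_i=\frac1{h^\alpha}\left(\sum_{k=0}^{M-i+1}g_{k,\lambda}v_{i+k-1}-\phi(\lambda)v_i\right).$$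
   Formalization: The formal theorem assumes c_l+c_r>0 (not just nonzero) and that f is twice differentiable in t on [0,T] with second derivative bounded uniformly in x; without either one the estimate can fail. *)

theory Defs
  imports "HOL-Analysis.Analysis"
begin

section \<open>The tempered fractional diffusion problem\<close>

definition left_RL_integral :: "real \<Rightarrow> real \<Rightarrow> (real \<Rightarrow> real) \<Rightarrow> real \<Rightarrow> real" where
  "left_RL_integral a \<beta> v x =
     1 / Gamma \<beta> * integral {a..x} (\<lambda>\<xi>. (x - \<xi>) powr (\<beta> - 1) * v \<xi>)"

definition right_RL_integral :: "real \<Rightarrow> real \<Rightarrow> (real \<Rightarrow> real) \<Rightarrow> real \<Rightarrow> real" where
  "right_RL_integral b \<beta> v x =
     1 / Gamma \<beta> * integral {x..b} (\<lambda>\<xi>. (\<xi> - x) powr (\<beta> - 1) * v \<xi>)"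

text \<open>The integer \<open>n\<close> with \<open>n - 1 \<le> \<alpha> < n\<close>, for \<open>\<alpha> \<ge> 0\<close>.\<close>

definition RL_order :: "real \<Rightarrow> nat" where
  "RL_order \<alpha> = nat \<lfloor>\<alpha>\<rfloor> + 1"

definition left_RL_deriv :: "real \<Rightarrow> real \<Rightarrow> (real \<Rightarrow> real) \<Rightarrow> real \<Rightarrow> real" where
  "left_RL_deriv a \<alpha> v x =
     (deriv ^^ RL_order \<alpha>) (left_RL_integral a (real (RL_order \<alpha>) - \<alpha>) v) x"

definition right_RL_deriv :: "real \<Rightarrow> real \<Rightarrow> (real \<Rightarrow> real) \<Rightarrow> real \<Rightarrow> real" where
  "right_RL_deriv b \<alpha> v x =
     (-1) ^ RL_order \<alpha> *
     (deriv ^^ RL_order \<alpha>) (right_RL_integral b (real (RL_order \<alpha>) - \<alpha>) v) x"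

text \<open>\<open>integral\<close> and \<open>deriv\<close> are total, so the existence of the fractional derivatives
  on \<open>(a, b)\<close> has to be expressed separately.\<close>

definition left_RL_differentiable :: "real \<Rightarrow> real \<Rightarrow> real \<Rightarrow> (real \<Rightarrow> real) \<Rightarrow> bool" where
  "left_RL_differentiable a b \<alpha> v \<longleftrightarrow>
     (\<forall>x\<in>{a<..<b}.
        (\<lambda>\<xi>. (x - \<xi>) powr (real (RL_order \<alpha>) - \<alpha> - 1) * v \<xi>) absolutely_integrable_on {a..x} \<and>
        (\<forall>k<RL_order \<alpha>.
           (deriv ^^ k) (left_RL_integral a (real (RL_order \<alpha>) - \<alpha>) v)
             field_differentiable (at x)))"

definition right_RL_differentiable :: "real \<Rightarrow> real \<Rightarrow> real \<Rightarrow> (real \<Rightarrow> real) \<Rightarrow> bool" where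
  "right_RL_differentiable a b \<alpha> v \<longleftrightarrow>
     (\<forall>x\<in>{a<..<b}.
        (\<lambda>\<xi>. (\<xi> - x) powr (real (RL_order \<alpha>) - \<alpha> - 1) * v \<xi>) absolutely_integrable_on {x..b} \<and>
        (\<forall>k<RL_order \<alpha>.
           (deriv ^^ k) (right_RL_integral b (real (RL_order \<alpha>) - \<alpha>) v)
             field_differentiable (at x)))"

definition left_tempered_deriv ::
  "real \<Rightarrow> real \<Rightarrow> real \<Rightarrow> (real \<Rightarrow> real) \<Rightarrow> real \<Rightarrow> real" where
  "left_tempered_deriv a \<alpha> lam v x =
     exp (- lam * x) * left_RL_deriv a \<alpha> (\<lambda>\<xi>. exp (lam * \<xi>) * v \<xi>) x - lam powr \<alpha> * v x"

definition right_tempered_deriv ::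
  "real \<Rightarrow> real \<Rightarrow> real \<Rightarrow> (real \<Rightarrow> real) \<Rightarrow> real \<Rightarrow> real" where
  "right_tempered_deriv b \<alpha> lam v x =
     exp (lam * x) * right_RL_deriv b \<alpha> (\<lambda>\<xi>. exp (- lam * \<xi>) * v \<xi>) x - lam powr \<alpha> * v x"

text \<open>Functions of space and time are written \<open>u x t\<close>. The existence of a one-sided
  fractional derivative is demanded only if it occurs in the equation with a nonzero
  coefficient.\<close>

definition solves_tempered_diffusion ::
  "real \<Rightarrow> real \<Rightarrow> real \<Rightarrow> real \<Rightarrow> real \<Rightarrow> real \<Rightarrow> real \<Rightarrow> (real \<Rightarrow> real \<Rightarrow> real) \<Rightarrow>
   (real \<Rightarrow> real) \<Rightarrow> (real \<Rightarrow> real) \<Rightarrow> (real \<Rightarrow> real) \<Rightarrow> (real \<Rightarrow> real \<Rightarrow> real) \<Rightarrow> bool" where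
  "solves_tempered_diffusion a b T \<alpha> lam cl cr f S \<Phi>l \<Phi>r u \<longleftrightarrow>
     (\<forall>t\<in>{0<..<T}.
        (cl \<noteq> 0 \<longrightarrow> left_RL_differentiable a b \<alpha> (\<lambda>\<xi>. exp (lam * \<xi>) * u \<xi> t)) \<and>
        (cr \<noteq> 0 \<longrightarrow> right_RL_differentiable a b \<alpha> (\<lambda>\<xi>. exp (- lam * \<xi>) * u \<xi> t))) \<and>
     (\<forall>x\<in>{a<..<b}. \<forall>t\<in>{0<..<T}.
        ((\<lambda>s. u x s) has_real_derivative
           cl * left_tempered_deriv a \<alpha> lam (\<lambda>\<xi>. u \<xi> t) x
         + cr * right_tempered_deriv b \<alpha> lam (\<lambda>\<xi>. u \<xi> t) x + f x t) (at t)) \<and>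
     (\<forall>x\<in>{a..b}. u x 0 = S x) \<and>
     (\<forall>t\<in>{0..T}. u a t = \<Phi>l t \<and> u b t = \<Phi>r t)"

text \<open>The regularity of the source term in time that makes
  \<open>(f x t + f x (t + \<tau>)) / 2\<close> and \<open>f x (t + \<tau> / 2)\<close> agree up to \<open>O(\<tau>\<^sup>2)\<close>,
  uniformly in \<open>x\<close>.\<close>

definition bounded_second_time_deriv ::
  "real \<Rightarrow> real \<Rightarrow> real \<Rightarrow> (real \<Rightarrow> real \<Rightarrow> real) \<Rightarrow> bool" where
  "bounded_second_time_deriv a b T f \<longleftrightarrow>
     (\<exists>ft ftt K. \<forall>x\<in>{a<..<b}. \<forall>t\<in>{0..T}.
        ((\<lambda>s. f x s) has_real_derivative ft x t) (at t within {0..T}) \<and>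
        ((\<lambda>s. ft x s) has_real_derivative ftt x t) (at t within {0..T}) \<and>
        \<bar>ftt x t\<bar> \<le> K)"

section \<open>Tempered weighted and shifted Gruenwald difference operators\<close>

definition gruenwald_coeff :: "real \<Rightarrow> nat \<Rightarrow> real" where
  "gruenwald_coeff \<alpha> k = (-1) ^ k * (\<alpha> gchoose k)"

definition gam1 :: "real \<Rightarrow> real \<Rightarrow> real" where
  "gam1 \<alpha> \<gamma>\<^sub>4 = \<alpha>\<^sup>2 / 8 + 5 / 24 * \<alpha> - \<gamma>\<^sub>4"

definition gam2 :: "real \<Rightarrow> real \<Rightarrow> real" where
  "gam2 \<alpha> \<gamma>\<^sub>4 = - (\<alpha>\<^sup>2 / 4) + 1 / 12 * \<alpha> + 1 + 3 * \<gamma>\<^sub>4"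

definition gam3 :: "real \<Rightarrow> real \<Rightarrow> real" where
  "gam3 \<alpha> \<gamma>\<^sub>4 = \<alpha>\<^sup>2 / 8 - 7 / 24 * \<alpha> - 3 * \<gamma>\<^sub>4"

definition tempered_weight :: "real \<Rightarrow> real \<Rightarrow> real \<Rightarrow> real \<Rightarrow> nat \<Rightarrow> real" where
  "tempered_weight \<alpha> lam \<gamma>\<^sub>4 h k =
     (if k = 0 then gam1 \<alpha> \<gamma>\<^sub>4 * gruenwald_coeff \<alpha> 0 * exp (h * lam)
      else if k = 1 then
        gam1 \<alpha> \<gamma>\<^sub>4 * gruenwald_coeff \<alpha> 1 + gam2 \<alpha> \<gamma>\<^sub>4 * gruenwald_coeff \<alpha> 0
      else if k = 2 then
        (gam1 \<alpha> \<gamma>\<^sub>4 * gruenwald_coeff \<alpha> 2 + gam2 \<alpha> \<gamma>\<^sub>4 * gruenwald_coeff \<alpha> 1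
         + gam3 \<alpha> \<gamma>\<^sub>4 * gruenwald_coeff \<alpha> 0) * exp (- h * lam)
      else
        (gam1 \<alpha> \<gamma>\<^sub>4 * gruenwald_coeff \<alpha> k + gam2 \<alpha> \<gamma>\<^sub>4 * gruenwald_coeff \<alpha> (k - 1)
         + gam3 \<alpha> \<gamma>\<^sub>4 * gruenwald_coeff \<alpha> (k - 2) + \<gamma>\<^sub>4 * gruenwald_coeff \<alpha> (k - 3))
        * exp (- (real k - 1) * h * lam))"

definition tempered_phi :: "real \<Rightarrow> real \<Rightarrow> real \<Rightarrow> real \<Rightarrow> real" where
  "tempered_phi \<alpha> lam \<gamma>\<^sub>4 h =
     (gam1 \<alpha> \<gamma>\<^sub>4 * exp (h * lam) + gam2 \<alpha> \<gamma>\<^sub>4 + gam3 \<alpha> \<gamma>\<^sub>4 * exp (- h * lam)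
      + \<gamma>\<^sub>4 * exp (- 2 * h * lam)) * (1 - exp (- h * lam)) powr \<alpha>"

text \<open>Both operators are meant for interior indices \<open>1 \<le> i \<le> M - 1\<close>. The indices of \<open>v\<close>
  are written so that subtraction on \<open>nat\<close> does not truncate there.\<close>

definition left_diff_op ::
  "real \<Rightarrow> real \<Rightarrow> real \<Rightarrow> real \<Rightarrow> (nat \<Rightarrow> real) \<Rightarrow> nat \<Rightarrow> real" where
  "left_diff_op \<alpha> lam \<gamma>\<^sub>4 h v i =
     1 / h powr \<alpha> *
     ((\<Sum>k=0..i+1. tempered_weight \<alpha> lam \<gamma>\<^sub>4 h k * v (i + 1 - k))
      - tempered_phi \<alpha> lam \<gamma>\<^sub>4 h * v i)"

definition right_diff_op ::
  "real \<Rightarrow> real \<Rightarrow> real \<Rightarrow> real \<Rightarrow> nat \<Rightarrow> (nat \<Rightarrow> real) \<Rightarrow> nat \<Rightarrow> real" where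
  "right_diff_op \<alpha> lam \<gamma>\<^sub>4 h M v i =
     1 / h powr \<alpha> *
     ((\<Sum>k=0..M-i+1. tempered_weight \<alpha> lam \<gamma>\<^sub>4 h k * v (i + k - 1))
      - tempered_phi \<alpha> lam \<gamma>\<^sub>4 h * v i)"

definition weight_symbol :: "real \<Rightarrow> real \<Rightarrow> real \<Rightarrow> real \<Rightarrow> nat \<Rightarrow> real \<Rightarrow> real" where
  "weight_symbol \<alpha> lam \<gamma>\<^sub>4 h M x =
     (\<Sum>k=0..M-1. tempered_weight \<alpha> lam \<gamma>\<^sub>4 h k * cos ((real k - 1) * x))
     - tempered_phi \<alpha> lam \<gamma>\<^sub>4 h"

section \<open>Grids and the two discrete equations\<close>

definition mesh :: "real \<Rightarrow> real \<Rightarrow> nat \<Rightarrow> real" where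
  "mesh p q n = (q - p) / real n"

text \<open>The index is real in order to cover the half-integer time levels.\<close>

definition node :: "real \<Rightarrow> real \<Rightarrow> nat \<Rightarrow> real \<Rightarrow> real" where
  "node p q n r = p + r * mesh p q n"

definition discrete_L2_norm :: "real \<Rightarrow> nat \<Rightarrow> (nat \<Rightarrow> real) \<Rightarrow> real" where
  "discrete_L2_norm h M e = sqrt (h * (\<Sum>i=1..M-1. (e i)\<^sup>2))"

definition space_op ::
  "real \<Rightarrow> real \<Rightarrow> real \<Rightarrow> real \<Rightarrow> real \<Rightarrow> real \<Rightarrow> nat \<Rightarrow> (nat \<Rightarrow> real) \<Rightarrow> nat \<Rightarrow> real" where
  "space_op \<alpha> lam \<gamma>\<^sub>4 cl cr h M v i =
     cl * left_diff_op \<alpha> lam \<gamma>\<^sub>4 h v i + cr * right_diff_op \<alpha> lam \<gamma>\<^sub>4 h M v i"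

text \<open>A grid function \<open>w i j\<close> satisfies the difference equation up to an error of
  absolute value at most \<open>C * (\<tau>\<^sup>3 + \<tau> * h\<^sup>3)\<close>.\<close>

definition satisfies_perturbed_scheme ::
  "real \<Rightarrow> real \<Rightarrow> real \<Rightarrow> real \<Rightarrow> real \<Rightarrow> real \<Rightarrow> real \<Rightarrow> real \<Rightarrow> (real \<Rightarrow> real \<Rightarrow> real) \<Rightarrow>
   nat \<Rightarrow> nat \<Rightarrow> real \<Rightarrow> (nat \<Rightarrow> nat \<Rightarrow> real) \<Rightarrow> bool" where
  "satisfies_perturbed_scheme a b T \<alpha> lam \<gamma>\<^sub>4 cl cr f M N C w \<longleftrightarrow>
     (let h = mesh a b M; \<tau> = mesh 0 T N in
      \<forall>i\<in>{1..M-1}. \<forall>j<N.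
        \<bar>(w i (j+1) - \<tau> / 2 * space_op \<alpha> lam \<gamma>\<^sub>4 cl cr h M (\<lambda>m. w m (j+1)) i)
         - (w i j + \<tau> / 2 * space_op \<alpha> lam \<gamma>\<^sub>4 cl cr h M (\<lambda>m. w m j) i
            + \<tau> * f (node a b M i) (node 0 T N (real j + 1 / 2)))\<bar>
        \<le> C * (\<tau> ^ 3 + \<tau> * h ^ 3))"

definition solves_scheme ::
  "real \<Rightarrow> real \<Rightarrow> real \<Rightarrow> real \<Rightarrow> real \<Rightarrow> real \<Rightarrow> real \<Rightarrow> real \<Rightarrow> (real \<Rightarrow> real \<Rightarrow> real) \<Rightarrow>
   (real \<Rightarrow> real) \<Rightarrow> (real \<Rightarrow> real) \<Rightarrow> (real \<Rightarrow> real) \<Rightarrow>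
   nat \<Rightarrow> nat \<Rightarrow> (nat \<Rightarrow> nat \<Rightarrow> real) \<Rightarrow> bool" where
  "solves_scheme a b T \<alpha> lam \<gamma>\<^sub>4 cl cr f S \<Phi>l \<Phi>r M N U \<longleftrightarrow>
     (let h = mesh a b M; \<tau> = mesh 0 T N in
      (\<forall>i\<in>{1..M-1}. \<forall>j<N.
        U i (j+1) - \<tau> / 2 * space_op \<alpha> lam \<gamma>\<^sub>4 cl cr h M (\<lambda>m. U m (j+1)) i
        = U i j + \<tau> / 2 * space_op \<alpha> lam \<gamma>\<^sub>4 cl cr h M (\<lambda>m. U m j) i
          + \<tau> * ((f (node a b M i) (node 0 T N j) + f (node a b M i) (node 0 T N (j+1))) / 2)) \<and>
      (\<forall>i\<le>M. U i 0 = S (node a b M i)) \<and>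
      (\<forall>j\<le>N. U 0 j = \<Phi>l (node 0 T N j) \<and> U M j = \<Phi>r (node 0 T N j)))"

end

theory Submission
  imports Defs
begin

text \<open>The error vanishes initially and on the boundary, so on it the right operator is the
  transpose of the left one and the quadratic form of \<open>c\<^sub>l L\<^sub>h + c\<^sub>r R\<^sub>h\<close> is \<open>c\<^sub>l + c\<^sub>r\<close> times that of \<open>L\<^sub>h\<close>.
  The latter is a Toeplitz form, equal up to a positive factor to the integral over \<open>[0, 2\<pi>]\<close> of the
  symbol against \<open>\<bar>\<Sum> v\<^sub>j e\<^bsup>ijx\<^esup>\<bar>\<^sup>2\<close>, hence nonpositive. Testing the error equation with
  \<open>E\<^bsup>j+1\<^esup> + E\<^bsup>j\<^esup>\<close> then shows that the norm of the error grows per step by at most the norm of the residual,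
  which is \<open>O(\<tau>(\<tau>\<^sup>2 + h\<^sup>3))\<close>.\<close>

section \<open>The Toeplitz form of the weights\<close>

lemma has_integral_cos_int:
  fixes n :: int
  shows "((\<lambda>x. cos (of_int n * x)) has_integral (if n = 0 then 2 * pi else 0)) {0..2 * pi}"
proof (cases "n = 0")
  case True
  then show ?thesis
    using has_integral_const_real[of "1::real" 0 "2 * pi"] by simp
next
  case False
  have "((\<lambda>x. cos (of_int n * x)) has_integral
      (sin (of_int n * (2 * pi)) / of_int n - sin (of_int n * 0) / of_int n)) {0..2 * pi}"
  proof (rule fundamental_theorem_of_calculus)
    fix x :: real
    show "((\<lambda>x. sin (of_int n * x) / of_int n) has_vector_derivative cos (of_int n * x))
        (at x within {0..2 * pi})"
      using False unfolding has_real_derivative_iff_has_vector_derivative[symmetric]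
      by (auto intro!: derivative_eq_intros)
  qed simp
  moreover have "sin (of_int n * (2 * pi)) = 0"
    using sin_int_2pin[of n] by (simp add: mult_ac)
  ultimately show ?thesis using False by simp
qed

text \<open>Product-to-sum reduces this to the previous integral. The value is a sum of two
  indicators because cosine is even; at \<open>m = n = 0\<close> both fire and give the exceptional
  value 2 pi with no separate case.\<close>

lemma has_integral_cos_mult_cos_int:
  fixes m n :: int
  shows "((\<lambda>x. cos (of_int m * x) * cos (of_int n * x)) has_integral
    ((if m = n then pi else 0) + (if m = - n then pi else 0))) {0..2 * pi}"
proof -
  have "((\<lambda>x. 1 / 2 * (cos (of_int (m - n) * x) + cos (of_int (m + n) * x))) has_integral
      1 / 2 * ((if m - n = 0 then 2 * pi else 0) + (if m + n = 0 then 2 * pi else 0))) {0..2 * pi}"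
    by (intro has_integral_mult_right has_integral_add has_integral_cos_int)
  moreover have "1 / 2 * ((if m - n = 0 then 2 * pi else 0) + (if m + n = 0 then 2 * pi else 0))
      = (if m = n then pi else 0) + (if m = - n then pi else 0)" by auto
  moreover have "1 / 2 * (cos (of_int (m - n) * x) + cos (of_int (m + n) * x))
      = cos (of_int m * x) * cos (of_int n * x)" for x :: real
    by (simp add: cos_times_cos algebra_simps)
  ultimately show ?thesis by (simp only:)
qed

text \<open>Lower Hessenberg Toeplitz matrix: the shift by one in the Gruenwald formula puts
  \<open>g 1\<close> on the diagonal and \<open>g 0\<close> on the superdiagonal. Without the guard,
  truncated subtraction would fill everything further right with \<open>g 0\<close>.\<close>

definition toeplitz_entry :: "(nat \<Rightarrow> real) \<Rightarrow> nat \<Rightarrow> nat \<Rightarrow> real" where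
  "toeplitz_entry g i j = (if j \<le> i + 1 then g (i + 1 - j) else 0)"

text \<open>The squared modulus of the trigonometric polynomial with coefficients \<open>v\<close>,
  in real terms; it serves as a nonnegative integration weight.\<close>

lemma trig_poly_square:
  fixes v :: "nat \<Rightarrow> real"
  shows "(\<Sum>i\<in>I. \<Sum>j\<in>I. v i * v j * cos (of_int (int i - int j) * x))
    = (\<Sum>i\<in>I. v i * cos (real i * x))\<^sup>2 + (\<Sum>i\<in>I. v i * sin (real i * x))\<^sup>2"
  by (simp add: power2_eq_square sum_product sum.distrib[symmetric] cos_diff algebra_simps)

text \<open>The integral of symbol times weight is computed in two ways: its sign is read off
  pointwise, and its value follows from orthogonality of the cosines.\<close>

lemma toeplitz_form_nonpos:
  fixes g v :: "nat \<Rightarrow> real"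
  assumes "\<And>x. (\<Sum>k=0..M-1. g k * cos ((real k - 1) * x)) - \<phi> \<le> 0"
  shows "(\<Sum>i=1..M-1. \<Sum>j=1..M-1. toeplitz_entry g i j * v i * v j) \<le> \<phi> * (\<Sum>i=1..M-1. (v i)\<^sup>2)"
proof -
  let ?I = "{1..M-1}"
  let ?c = "\<lambda>n x. cos (of_int n * x) :: real"
  let ?Q = "\<Sum>i\<in>?I. \<Sum>j\<in>?I. toeplitz_entry g i j * v i * v j"
  define \<delta> :: "int \<Rightarrow> int \<Rightarrow> real"
    where "\<delta> m n = (if m = n then pi else 0) + (if m = - n then pi else 0)" for m n
  have cc: "((\<lambda>x. ?c m x * ?c n x) has_integral \<delta> m n) {0..2 * pi}" for m n
    unfolding \<delta>_def by (rule has_integral_cos_mult_cos_int)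
  define W where "W x = (\<Sum>i\<in>?I. \<Sum>j\<in>?I. v i * v j * ?c (int i - int j) x)" for x
  have W_nonneg: "0 \<le> W x" for x unfolding W_def trig_poly_square by simp
  \<comment> \<open>The termwise value of the integral. The constant \<open>\<phi>\<close> is
    treated as a coefficient of frequency 0, so that one orthogonality rule covers all
    terms.\<close>
  define J where "J = (\<Sum>i\<in>?I. \<Sum>j\<in>?I. v i * v j *
      ((\<Sum>k=0..M-1. g k * \<delta> (int k - 1) (int i - int j)) - \<phi> * \<delta> 0 (int i - int j)))"
  have "((\<lambda>x. \<Sum>i\<in>?I. \<Sum>j\<in>?I. v i * v j *
      ((\<Sum>k=0..M-1. g k * (?c (int k - 1) x * ?c (int i - int j) x))
        - \<phi> * (?c 0 x * ?c (int i - int j) x))) has_integral J) {0..2 * pi}"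
    unfolding J_def
    by (intro has_integral_sum has_integral_mult_right has_integral_diff cc) auto
  moreover have "(\<Sum>i\<in>?I. \<Sum>j\<in>?I. v i * v j *
      ((\<Sum>k=0..M-1. g k * (?c (int k - 1) x * ?c (int i - int j) x))
        - \<phi> * (?c 0 x * ?c (int i - int j) x)))
      = ((\<Sum>k=0..M-1. g k * cos ((real k - 1) * x)) - \<phi>) * W x" for x
    unfolding W_def sum_distrib_left
    by (intro sum.cong refl)
       (simp add: algebra_simps sum_distrib_left sum_distrib_right)
  ultimately have "((\<lambda>x. ((\<Sum>k=0..M-1. g k * cos ((real k - 1) * x)) - \<phi>) * W x) has_integral J)
      {0..2 * pi}" by simp
  from has_integral_neg[OF this] have "0 \<le> - J"
    by (rule has_integral_nonneg) (use assms W_nonneg in \<open>simp add: mult_nonpos_nonneg\<close>)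
  moreover have "J = 2 * pi * (?Q - \<phi> * (\<Sum>i\<in>?I. (v i)\<^sup>2))"
  proof -
    \<comment> \<open>Cosine does not see the sign of \<open>i - j\<close>, so each pair picks up
      both the entry and its transpose.\<close>
    have entry: "(\<Sum>k=0..M-1. g k * \<delta> (int k - 1) (int i - int j))
        = pi * (toeplitz_entry g i j + toeplitz_entry g j i)" if "i \<in> ?I" "j \<in> ?I" for i j
    proof -
      have half: "(\<Sum>k=0..M-1. if int k - 1 = int p - int q then g k * pi else 0)
          = pi * toeplitz_entry g p q" if "p \<in> ?I" "q \<in> ?I" for p q
      proof (cases "q \<le> p + 1")
        case True
        \<comment> \<open>At most one index contributes. Since \<open>p \<le> M - 1\<close> and
          \<open>q \<ge> 1\<close>, it is at most \<open>M - 1\<close>, so cutting the symbol off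
          there loses nothing.\<close>
        then have "int k - 1 = int p - int q \<longleftrightarrow> k = p + 1 - q" for k by auto
        moreover have "p + 1 - q \<in> {0..M-1}" using that by auto
        ultimately show ?thesis using True by (simp add: toeplitz_entry_def)
      next
        case False
        then have "int k - 1 \<noteq> int p - int q" for k by auto
        then show ?thesis using False by (simp add: toeplitz_entry_def)
      qed
      have "g k * \<delta> (int k - 1) (int i - int j)
          = (if int k - 1 = int i - int j then g k * pi else 0)
            + (if int k - 1 = int j - int i then g k * pi else 0)" for k
        unfolding \<delta>_def by (auto simp: algebra_simps)
      then show ?thesis
        using half[OF that] half[OF that(2,1)]
        by (simp only: sum.distrib) (simp add: distrib_left)
    qed
    have diag: "(\<Sum>j\<in>?I. v i * v j * (\<phi> * \<delta> 0 (int i - int j))) = 2 * pi * (\<phi> * (v i)\<^sup>2)"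
      if "i \<in> ?I" for i
    proof -
      have "v i * v j * (\<phi> * \<delta> 0 (int i - int j)) = (if i = j then 2 * pi * (\<phi> * (v i)\<^sup>2) else 0)" for j
        by (auto simp: \<delta>_def power2_eq_square)
      then show ?thesis using that by simp
    qed
    have "J = (\<Sum>i\<in>?I. \<Sum>j\<in>?I. v i * v j * (pi * (toeplitz_entry g i j + toeplitz_entry g j i)))
        - (\<Sum>i\<in>?I. \<Sum>j\<in>?I. v i * v j * (\<phi> * \<delta> 0 (int i - int j)))"
      unfolding J_def sum_subtractf[symmetric] by (intro sum.cong refl) (simp only: entry right_diff_distrib)
    also have "(\<Sum>i\<in>?I. \<Sum>j\<in>?I. v i * v j * (\<phi> * \<delta> 0 (int i - int j)))
        = 2 * pi * (\<phi> * (\<Sum>i\<in>?I. (v i)\<^sup>2))"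
      using diag by (simp add: sum_distrib_left)
    also have "(\<Sum>i\<in>?I. \<Sum>j\<in>?I. v i * v j * (pi * (toeplitz_entry g i j + toeplitz_entry g j i)))
        = pi * ?Q + pi * (\<Sum>i\<in>?I. \<Sum>j\<in>?I. toeplitz_entry g j i * v j * v i)"
      unfolding sum_distrib_left sum.distrib[symmetric]
      by (intro sum.cong refl) (simp add: algebra_simps)
    also have "(\<Sum>i\<in>?I. \<Sum>j\<in>?I. toeplitz_entry g j i * v j * v i) = ?Q"
      by (rule sum.swap)
    finally show ?thesis by (simp add: algebra_simps)
  qed
  ultimately have "2 * pi * (?Q - \<phi> * (\<Sum>i\<in>?I. (v i)\<^sup>2)) \<le> 0" by simp
  then have "\<not> 0 < ?Q - \<phi> * (\<Sum>i\<in>?I. (v i)\<^sup>2)"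
    using pi_gt_zero by (meson not_le mult_pos_pos zero_less_numeral)
  then show ?thesis by simp
qed

section \<open>Negativity of the spatial operator\<close>

text \<open>With \<open>j = i + 1 - k\<close> the sum becomes a matrix row. Entries beyond column
  \<open>i + 1\<close> are zero, and the zero boundary values remove columns 0 and
  \<open>M\<close>.\<close>

lemma left_diff_op_toeplitz:
  assumes "v 0 = 0" "v M = 0" "i \<in> {1..M-1}"
  shows "left_diff_op \<alpha> lam \<gamma>\<^sub>4 h v i = 1 / h powr \<alpha> *
    ((\<Sum>j=1..M-1. toeplitz_entry (tempered_weight \<alpha> lam \<gamma>\<^sub>4 h) i j * v j)
      - tempered_phi \<alpha> lam \<gamma>\<^sub>4 h * v i)"
proof -
  let ?g = "tempered_weight \<alpha> lam \<gamma>\<^sub>4 h"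
  have "(\<Sum>k=0..i+1. ?g k * v (i + 1 - k)) = (\<Sum>j=0..i+1. ?g (i + 1 - j) * v j)"
    by (rule sum.reindex_bij_witness[of _ "\<lambda>j. i + 1 - j" "\<lambda>j. i + 1 - j"]) auto
  also have "\<dots> = (\<Sum>j=0..i+1. toeplitz_entry ?g i j * v j)"
    by (intro sum.cong refl) (simp add: toeplitz_entry_def)
  also have "\<dots> = (\<Sum>j=0..M. toeplitz_entry ?g i j * v j)"
    by (rule sum.mono_neutral_left) (use assms in \<open>auto simp: toeplitz_entry_def\<close>)
  also have "\<dots> = (\<Sum>j=1..M-1. toeplitz_entry ?g i j * v j)"
  proof (rule sum.mono_neutral_right)
    have "j = 0 \<or> j = M" if "j \<in> {0..M} - {1..M-1}" for j using that by auto
    then show "\<forall>j\<in>{0..M} - {1..M-1}. toeplitz_entry ?g i j * v j = 0" using assms by fastforce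
  qed auto
  finally show ?thesis by (simp add: left_diff_op_def)
qed

text \<open>Here \<open>j = i + k - 1\<close>, so the weight index is \<open>j + 1 - i\<close>: the
  roles of \<open>i\<close> and \<open>j\<close> are exchanged, which is the transposed
  matrix.\<close>

lemma right_diff_op_toeplitz:
  assumes "v 0 = 0" "v M = 0" "i \<in> {1..M-1}"
  shows "right_diff_op \<alpha> lam \<gamma>\<^sub>4 h M v i = 1 / h powr \<alpha> *
    ((\<Sum>j=1..M-1. toeplitz_entry (tempered_weight \<alpha> lam \<gamma>\<^sub>4 h) j i * v j)
      - tempered_phi \<alpha> lam \<gamma>\<^sub>4 h * v i)"
proof -
  let ?g = "tempered_weight \<alpha> lam \<gamma>\<^sub>4 h"
  have "(\<Sum>k=0..M-i+1. ?g k * v (i + k - 1)) = (\<Sum>j=i-1..M. ?g (j + 1 - i) * v j)"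
    by (rule sum.reindex_bij_witness[of _ "\<lambda>j. j + 1 - i" "\<lambda>k. i + k - 1"]) (use assms in auto)
  also have "\<dots> = (\<Sum>j=i-1..M. toeplitz_entry ?g j i * v j)"
    by (intro sum.cong refl) (auto simp: toeplitz_entry_def)
  also have "\<dots> = (\<Sum>j=0..M. toeplitz_entry ?g j i * v j)"
    by (rule sum.mono_neutral_left) (use assms in \<open>auto simp: toeplitz_entry_def\<close>)
  also have "\<dots> = (\<Sum>j=1..M-1. toeplitz_entry ?g j i * v j)"
  proof (rule sum.mono_neutral_right)
    have "j = 0 \<or> j = M" if "j \<in> {0..M} - {1..M-1}" for j using that by auto
    then show "\<forall>j\<in>{0..M} - {1..M-1}. toeplitz_entry ?g j i * v j = 0" using assms by fastforce
  qed auto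
  finally show ?thesis by (simp add: right_diff_op_def)
qed

text \<open>A matrix and its transpose have the same quadratic form, so \<open>cl\<close> and
  \<open>cr\<close> enter only through their sum; one of them may be negative.\<close>

lemma space_op_form_nonpos:
  assumes "v 0 = 0" "v M = 0" "0 \<le> cl + cr"
    and "\<And>x. weight_symbol \<alpha> lam \<gamma>\<^sub>4 h M x \<le> 0"
  shows "(\<Sum>i=1..M-1. space_op \<alpha> lam \<gamma>\<^sub>4 cl cr h M v i * v i) \<le> 0"
proof -
  let ?I = "{1..M-1}"
  let ?G = "toeplitz_entry (tempered_weight \<alpha> lam \<gamma>\<^sub>4 h)"
  let ?\<phi> = "tempered_phi \<alpha> lam \<gamma>\<^sub>4 h"
  let ?Q = "\<Sum>i\<in>?I. \<Sum>j\<in>?I. ?G i j * v i * v j"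
  have left: "(\<Sum>i\<in>?I. left_diff_op \<alpha> lam \<gamma>\<^sub>4 h v i * v i)
      = 1 / h powr \<alpha> * (?Q - ?\<phi> * (\<Sum>i\<in>?I. (v i)\<^sup>2))"
    unfolding sum_distrib_left sum_subtractf[symmetric]
    by (intro sum.cong refl)
       (simp add: left_diff_op_toeplitz[OF assms(1,2)] left_diff_distrib right_diff_distrib sum_distrib_left
          power2_eq_square mult_ac)
  have "(\<Sum>i\<in>?I. right_diff_op \<alpha> lam \<gamma>\<^sub>4 h M v i * v i)
      = 1 / h powr \<alpha> * ((\<Sum>i\<in>?I. \<Sum>j\<in>?I. ?G j i * v j * v i) - ?\<phi> * (\<Sum>i\<in>?I. (v i)\<^sup>2))"
    unfolding sum_distrib_left sum_subtractf[symmetric]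
    by (intro sum.cong refl)
       (simp add: right_diff_op_toeplitz[OF assms(1,2)] left_diff_distrib right_diff_distrib sum_distrib_left
          power2_eq_square mult_ac)
  also have "(\<Sum>i\<in>?I. \<Sum>j\<in>?I. ?G j i * v j * v i) = ?Q" by (rule sum.swap)
  finally have right: "(\<Sum>i\<in>?I. right_diff_op \<alpha> lam \<gamma>\<^sub>4 h M v i * v i)
      = 1 / h powr \<alpha> * (?Q - ?\<phi> * (\<Sum>i\<in>?I. (v i)\<^sup>2))" .
  have "(\<Sum>i\<in>?I. space_op \<alpha> lam \<gamma>\<^sub>4 cl cr h M v i * v i)
      = cl * (\<Sum>i\<in>?I. left_diff_op \<alpha> lam \<gamma>\<^sub>4 h v i * v i)
        + cr * (\<Sum>i\<in>?I. right_diff_op \<alpha> lam \<gamma>\<^sub>4 h M v i * v i)"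
    by (simp add: space_op_def sum_distrib_left sum.distrib distrib_right mult.assoc)
  also have "\<dots> = (cl + cr) * (1 / h powr \<alpha> * (?Q - ?\<phi> * (\<Sum>i\<in>?I. (v i)\<^sup>2)))"
    unfolding left right by (simp only: distrib_right)
  also have "\<dots> \<le> 0"
    using toeplitz_form_nonpos[where M = M and g = "tempered_weight \<alpha> lam \<gamma>\<^sub>4 h" and \<phi> = ?\<phi>] assms(3,4)
    by (intro mult_nonneg_nonpos) (auto simp: weight_symbol_def)
  finally show ?thesis .
qed

lemma space_op_add:
  "space_op \<alpha> lam \<gamma>\<^sub>4 cl cr h M (\<lambda>m. v m + w m) i
    = space_op \<alpha> lam \<gamma>\<^sub>4 cl cr h M v i + space_op \<alpha> lam \<gamma>\<^sub>4 cl cr h M w i"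
  unfolding space_op_def left_diff_op_def right_diff_op_def distrib_left sum.distrib
  by (simp add: algebra_simps diff_divide_distrib add_divide_distrib)

lemma space_op_diff:
  "space_op \<alpha> lam \<gamma>\<^sub>4 cl cr h M (\<lambda>m. v m - w m) i
    = space_op \<alpha> lam \<gamma>\<^sub>4 cl cr h M v i - space_op \<alpha> lam \<gamma>\<^sub>4 cl cr h M w i"
  using space_op_add[of \<alpha> lam \<gamma>\<^sub>4 cl cr h M "\<lambda>m. v m - w m" w i] by simp

section \<open>Crank--Nicolson stability\<close>

text \<open>Energy estimate: pairing the equation with \<open>e' + e\<close> yields the difference
  of the squared norms. The \<open>A\<close> part is nonpositive, and Cauchy-Schwarz with the
  triangle inequality bounds the rest by the residual norm times the sum of the two norms. That sum
  cancels, leaving an estimate with no growth factor.\<close>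

lemma L2_set_step:
  fixes e e' \<rho> A :: "nat \<Rightarrow> real"
  assumes "0 \<le> \<tau>" and eq: "\<And>i. i \<in> I \<Longrightarrow> e' i - e i = \<tau> * A i + \<rho> i"
    and "(\<Sum>i\<in>I. A i * (e' i + e i)) \<le> 0"
  shows "L2_set e' I \<le> L2_set e I + L2_set \<rho> I"
proof -
  let ?E = "L2_set e I" and ?E' = "L2_set e' I" and ?R = "L2_set \<rho> I"
  have "(?E' - ?E) * (?E' + ?E) = (\<Sum>i\<in>I. (e' i)\<^sup>2) - (\<Sum>i\<in>I. (e i)\<^sup>2)"
    unfolding L2_set_def by (simp add: algebra_simps sum_nonneg)
  also have "\<dots> = (\<Sum>i\<in>I. (e' i - e i) * (e' i + e i))"
    by (simp add: sum_subtractf[symmetric] power2_eq_square algebra_simps)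
  also have "\<dots> = (\<Sum>i\<in>I. (\<tau> * A i + \<rho> i) * (e' i + e i))"
    by (intro sum.cong refl) (simp add: eq)
  also have "\<dots> = \<tau> * (\<Sum>i\<in>I. A i * (e' i + e i)) + (\<Sum>i\<in>I. \<rho> i * (e' i + e i))"
    by (simp add: sum_distrib_left sum.distrib[symmetric] algebra_simps)
  also have "\<dots> \<le> 0 + (\<Sum>i\<in>I. \<bar>\<rho> i\<bar> * \<bar>e' i + e i\<bar>)"
    using assms by (intro add_mono mult_nonneg_nonpos sum_mono) (auto simp: abs_mult[symmetric])
  also have "\<dots> \<le> 0 + ?R * L2_set (\<lambda>i. e' i + e i) I"
    by (intro add_left_mono L2_set_mult_ineq)
  also have "\<dots> \<le> ?R * (?E' + ?E)"
    using L2_set_triangle_ineq[of e' e I] by (simp add: mult_left_mono)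
  finally have *: "(?E' - ?E) * (?E' + ?E) \<le> ?R * (?E' + ?E)" .
  have nonneg: "0 \<le> ?E" "0 \<le> ?E'" "0 \<le> ?R" by simp_all
  show ?thesis
  \<comment> \<open>Cancelling needs a positive factor; if the sum vanishes, both norms do.\<close>
  proof (cases "?E' + ?E = 0")
    case True
    then show ?thesis using nonneg by linarith
  next
    case False
    then have "0 < ?E' + ?E" using nonneg by linarith
    with * have "?E' - ?E \<le> ?R" by (simp only: mult_le_cancel_right_pos)
    then show ?thesis by simp
  qed
qed

text \<open>Each step adds at most the residual norm, so the error grows linearly in
  \<open>j\<close>. The factor \<open>sqrt (real (M - 1))\<close> converts the pointwise bound
  \<open>B\<close> into a Euclidean one.\<close>

lemma crank_nicolson_error_bound:
  fixes e :: "nat \<Rightarrow> nat \<Rightarrow> real"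
  assumes "0 \<le> \<tau>" "0 \<le> cl + cr" "0 \<le> B"
    and symbol: "\<And>x. weight_symbol \<alpha> lam \<gamma>\<^sub>4 h M x \<le> 0"
    and boundary: "\<And>j. j \<le> N \<Longrightarrow> e 0 j = 0 \<and> e M j = 0"
    and initial: "\<And>i. i \<in> {1..M-1} \<Longrightarrow> e i 0 = 0"
    and residual: "\<And>i j. i \<in> {1..M-1} \<Longrightarrow> j < N \<Longrightarrow>
      \<bar>e i (Suc j) - \<tau> / 2 * space_op \<alpha> lam \<gamma>\<^sub>4 cl cr h M (\<lambda>m. e m (Suc j)) i
        - (e i j + \<tau> / 2 * space_op \<alpha> lam \<gamma>\<^sub>4 cl cr h M (\<lambda>m. e m j) i)\<bar> \<le> B"
  shows "j \<le> N \<Longrightarrow> L2_set (\<lambda>i. e i j) {1..M-1} \<le> real j * (sqrt (real (M - 1)) * B)"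
proof (induction j)
  case 0
  have "L2_set (\<lambda>i. e i 0) {1..M-1} = 0"
    using initial by (simp add: L2_set_def)
  then show ?case by simp
next
  case (Suc j)
  let ?A = "space_op \<alpha> lam \<gamma>\<^sub>4 cl cr h M"
  define \<rho> where "\<rho> i = e i (Suc j) - \<tau> / 2 * ?A (\<lambda>m. e m (Suc j)) i
      - (e i j + \<tau> / 2 * ?A (\<lambda>m. e m j) i)" for i
  have "L2_set (\<lambda>i. e i (Suc j)) {1..M-1} \<le> L2_set (\<lambda>i. e i j) {1..M-1} + L2_set \<rho> {1..M-1}"
  proof (rule L2_set_step)
    show "0 \<le> \<tau> / 2" using assms(1) by simp
    \<comment> \<open>Additivity merges the two time levels into the operator applied to their sum,
      the same vector that the equation is tested with.\<close>
    show "e i (Suc j) - e i j = \<tau> / 2 * ?A (\<lambda>m. e m (Suc j) + e m j) i + \<rho> i" for i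
      unfolding \<rho>_def space_op_add by (simp add: distrib_left)
    show "(\<Sum>i=1..M-1. ?A (\<lambda>m. e m (Suc j) + e m j) i * (e i (Suc j) + e i j)) \<le> 0"
      by (rule space_op_form_nonpos) (use boundary[of j] boundary[of "Suc j"] Suc.prems assms(2) symbol in auto)
  qed
  also have "L2_set \<rho> {1..M-1} \<le> sqrt (\<Sum>i=1..M-1. B\<^sup>2)"
    unfolding L2_set_def
    using residual[of _ j] Suc.prems assms(3)
    by (intro real_sqrt_le_mono sum_mono) (auto simp: \<rho>_def intro!: power2_le_iff_abs_le[THEN iffD2])
  also have "\<dots> = sqrt (real (M - 1)) * B"
    using assms(3) by (simp add: real_sqrt_mult)
  finally show ?case using Suc by (simp add: algebra_simps)
qed

section \<open>The quadrature error of the source term\<close>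

text \<open>In the symmetrised function \<open>g\<close> the first-order terms cancel: its
  derivative \<open>f' (c + s) - f' (c - s)\<close> is at most \<open>2 * K * d\<close>, because
  \<open>f'\<close> is \<open>K\<close>-Lipschitz. The mean value bound on \<open>{0..d}\<close>
  supplies the second factor \<open>d\<close>.\<close>

lemma midpoint_trapezoid_bound:
  fixes f f' f'' :: "real \<Rightarrow> real"
  assumes f': "\<And>t. t \<in> {p..q} \<Longrightarrow> (f has_real_derivative f' t) (at t within {p..q})"
    and f'': "\<And>t. t \<in> {p..q} \<Longrightarrow> (f' has_real_derivative f'' t) (at t within {p..q})"
    and K: "\<And>t. t \<in> {p..q} \<Longrightarrow> \<bar>f'' t\<bar> \<le> K"
    and d: "0 \<le> d" "p \<le> c - d" "c + d \<le> q"
  shows "\<bar>f c - (f (c - d) + f (c + d)) / 2\<bar> \<le> K * d\<^sup>2"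
proof -
  have K0: "0 \<le> K" using K[of c] d by auto
  have lip: "\<bar>f' x - f' y\<bar> \<le> K * \<bar>x - y\<bar>" if "x \<in> {p..q}" "y \<in> {p..q}" for x y
    using field_differentiable_bound[OF _ f'', of K x y] K that by auto
  define g where "g s = f (c + s) + f (c - s)" for s
  have g': "(g has_real_derivative f' (c + s) - f' (c - s)) (at s within {0..d})"
    if s: "s \<in> {0..d}" for s
  proof -
    \<comment> \<open>The sign \<open>\<sigma>\<close> treats both branches at once. The image of
      \<open>{0..d}\<close> stays inside \<open>{p..q}\<close>, so one-sided derivatives at the end
      points suffice.\<close>
    have half: "((\<lambda>s. f (c + \<sigma> * s)) has_real_derivative f' (c + \<sigma> * s) * \<sigma>) (at s within {0..d})"
      if \<sigma>: "\<sigma> \<in> {- 1, 1}" for \<sigma> :: real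
    proof (rule DERIV_image_chain[of f _ "\<lambda>s. c + \<sigma> * s", unfolded o_def])
      show "(f has_real_derivative f' (c + \<sigma> * s)) (at (c + \<sigma> * s) within (\<lambda>s. c + \<sigma> * s) ` {0..d})"
        by (rule DERIV_subset[OF f']) (use \<sigma> s d in auto)
      show "((\<lambda>s. c + \<sigma> * s) has_real_derivative \<sigma>) (at s within {0..d})"
        by (auto intro!: derivative_eq_intros)
    qed
    show ?thesis
      using DERIV_add[OF half[of 1] half[of "- 1"]] unfolding g_def by simp
  qed
  have "\<bar>g d - g 0\<bar> \<le> (K * (2 * d)) * \<bar>d - 0\<bar>"
  proof -
    have "norm (f' (c + s) - f' (c - s)) \<le> K * (2 * d)" if "s \<in> {0..d}" for s
    proof -
      have "\<bar>f' (c + s) - f' (c - s)\<bar> \<le> K * \<bar>(c + s) - (c - s)\<bar>"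
        using that d by (intro lip) auto
      also have "\<dots> \<le> K * (2 * d)" using that K0 by (intro mult_left_mono) auto
      finally show ?thesis by simp
    qed
    then show ?thesis
      using field_differentiable_bound[OF _ g', of "K * (2 * d)" 0 d] d by auto
  qed
  then have "\<bar>f (c + d) + f (c - d) - 2 * f c\<bar> \<le> 2 * (K * d\<^sup>2)"
    using d by (simp add: g_def power2_eq_square mult_ac)
  then show ?thesis by (simp add: abs_le_iff field_simps)
qed

section \<open>Convergence of the scheme, from consistency and stability\<close>

theorem theorem3p10:
  fixes a b T \<alpha> lam \<gamma>\<^sub>4 cl cr C :: real
    and S \<Phi>l \<Phi>r :: "real \<Rightarrow> real"
    and f u :: "real \<Rightarrow> real \<Rightarrow> real"
  assumes "a < b" and "0 < T"
    and "1 < \<alpha>" and "\<alpha> < 2" and "0 \<le> lam"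
    and "0 < cl + cr"
    and "cl \<noteq> 0 \<Longrightarrow> \<forall>t\<in>{0..T}. \<Phi>l t = 0"
    and "cr \<noteq> 0 \<Longrightarrow> \<forall>t\<in>{0..T}. \<Phi>r t = 0"
    and "bounded_second_time_deriv a b T f"
    and "solves_tempered_diffusion a b T \<alpha> lam cl cr f S \<Phi>l \<Phi>r u"
  shows "\<exists>c>0. \<forall>M N U. 0 < M \<longrightarrow> 0 < N \<longrightarrow>
           satisfies_perturbed_scheme a b T \<alpha> lam \<gamma>\<^sub>4 cl cr f M N C
             (\<lambda>i j. u (node a b M i) (node 0 T N j)) \<longrightarrow>
           solves_scheme a b T \<alpha> lam \<gamma>\<^sub>4 cl cr f S \<Phi>l \<Phi>r M N U \<longrightarrow>
           (\<forall>x. weight_symbol \<alpha> lam \<gamma>\<^sub>4 (mesh a b M) M x < 0) \<longrightarrow>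
           (\<forall>j\<in>{1..N-1}.
              discrete_L2_norm (mesh a b M) M (\<lambda>i. u (node a b M i) (node 0 T N j) - U i j)
              \<le> c * ((mesh 0 T N)\<^sup>2 + (mesh a b M) ^ 3))"
proof -
  obtain ft ftt K where deriv:
    "\<And>x t. x \<in> {a<..<b} \<Longrightarrow> t \<in> {0..T} \<Longrightarrow>
      ((\<lambda>s. f x s) has_real_derivative ft x t) (at t within {0..T})"
    "\<And>x t. x \<in> {a<..<b} \<Longrightarrow> t \<in> {0..T} \<Longrightarrow>
      ((\<lambda>s. ft x s) has_real_derivative ftt x t) (at t within {0..T})"
    "\<And>x t. x \<in> {a<..<b} \<Longrightarrow> t \<in> {0..T} \<Longrightarrow> \<bar>ftt x t\<bar> \<le> K"
    using assms(9) unfolding bounded_second_time_deriv_def by metis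
  \<comment> \<open>Truncation constant plus quadrature constant; absolute values, since neither
    \<open>C\<close> nor \<open>K\<close> comes with a sign.\<close>
  define D where "D = \<bar>C\<bar> + \<bar>K\<bar>"
  \<comment> \<open>\<open>T\<close> will bound \<open>real j * \<tau>\<close>, and
    \<open>sqrt (b - a)\<close> will bound \<open>sqrt (real (M - 1) * h)\<close>. Adding 1 keeps
    \<open>c\<close> positive even if \<open>D = 0\<close>. The choice precedes \<open>M\<close>,
    \<open>N\<close> and \<open>U\<close>, so it is uniform in the grid.\<close>
  define c where "c = T * (sqrt (b - a) * D) + 1"
  have D: "0 \<le> D" by (simp add: D_def)
  then have cD: "0 \<le> T * (sqrt (b - a) * D)" using assms(1,2) by simp
  then have "0 < c" by (simp add: c_def)
  moreover have "discrete_L2_norm (mesh a b M) M (\<lambda>i. u (node a b M i) (node 0 T N j) - U i j)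
      \<le> c * ((mesh 0 T N)\<^sup>2 + (mesh a b M) ^ 3)"
    if M: "0 < M" and N: "0 < N"
      and perturbed: "satisfies_perturbed_scheme a b T \<alpha> lam \<gamma>\<^sub>4 cl cr f M N C
        (\<lambda>i j. u (node a b M i) (node 0 T N j))"
      and scheme: "solves_scheme a b T \<alpha> lam \<gamma>\<^sub>4 cl cr f S \<Phi>l \<Phi>r M N U"
      and symbol: "\<forall>x. weight_symbol \<alpha> lam \<gamma>\<^sub>4 (mesh a b M) M x < 0"
      and j: "j \<in> {1..N-1}" for M N U j
  proof -
    define h \<tau> where "h = mesh a b M" and "\<tau> = mesh 0 T N"
    define w where "w i j = u (node a b M i) (node 0 T N j)" for i j :: nat
    let ?A = "space_op \<alpha> lam \<gamma>\<^sub>4 cl cr h M"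
    have h: "0 < h" "real M * h = b - a" and \<tau>: "0 < \<tau>" "real N * \<tau> = T"
      using assms(1,2) M N by (auto simp: h_def \<tau>_def mesh_def)
    have x_eq: "node a b M r = a + r * h" and t_eq: "node 0 T N r = r * \<tau>" for r
      by (simp_all add: node_def h_def \<tau>_def)
    have x_mem: "node a b M (real i) \<in> {a..b}" if "i \<le> M" for i
      using mult_right_mono[of "real i" "real M" h] that h by (simp add: x_eq)
    \<comment> \<open>The time regularity of \<open>f\<close> is given only on the open space
      interval.\<close>
    have x_interior: "node a b M (real i) \<in> {a<..<b}" if "i \<in> {1..M-1}" for i
    proof -
      have "i < M" using that by auto
      then show ?thesis
        using mult_strict_right_mono[of "real i" "real M" h] that h by (auto simp: x_eq)
    qed
    have t_mem: "node 0 T N r \<in> {0..T}" if "0 \<le> r" "r \<le> real N" for r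
      using mult_right_mono[of r "real N" \<tau>] that \<tau> by (simp add: t_eq)
    have boundary: "w 0 j - U 0 j = 0 \<and> w M j - U M j = 0" if "j \<le> N" for j
      using scheme assms(10) t_mem[of "real j"] that h
      by (auto simp: solves_scheme_def solves_tempered_diffusion_def Let_def w_def x_eq)
    have initial: "w i 0 - U i 0 = 0" if "i \<in> {1..M-1}" for i
      using scheme assms(10) x_mem[of i] that
      by (auto simp: solves_scheme_def solves_tempered_diffusion_def Let_def w_def t_eq)
    \<comment> \<open>By linearity the two schemes subtract; what remains is the truncation error
      plus \<open>\<tau>\<close> times the gap between the midpoint value and the average of
      \<open>f\<close>.\<close>
    have residual: "\<bar>w i (Suc j) - U i (Suc j) - \<tau> / 2 * ?A (\<lambda>m. w m (Suc j) - U m (Suc j)) i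
        - (w i j - U i j + \<tau> / 2 * ?A (\<lambda>m. w m j - U m j) i)\<bar> \<le> \<tau> * (D * (\<tau>\<^sup>2 + h ^ 3))"
      if i: "i \<in> {1..M-1}" and j: "j < N" for i j
    proof -
      let ?x = "node a b M (real i)"
      let ?m = "node 0 T N (real j + 1 / 2)"
      define F where "F = (f ?x (node 0 T N (real j)) + f ?x (node 0 T N (real (j + 1)))) / 2"
      have scheme_eq: "U i (Suc j) - \<tau> / 2 * ?A (\<lambda>m. U m (Suc j)) i
          = U i j + \<tau> / 2 * ?A (\<lambda>m. U m j) i + \<tau> * F"
        using scheme i j by (simp add: solves_scheme_def Let_def h_def \<tau>_def F_def)
      have "\<bar>f ?x ?m - (f ?x (?m - \<tau> / 2) + f ?x (?m + \<tau> / 2)) / 2\<bar> \<le> K * (\<tau> / 2)\<^sup>2"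
      proof (rule midpoint_trapezoid_bound)
        show "0 \<le> ?m - \<tau> / 2" "?m + \<tau> / 2 \<le> T"
          using t_mem[of "real j"] t_mem[of "real j + 1"] j by (auto simp: t_eq algebra_simps)
      qed (use deriv x_interior[OF i] \<tau> in auto)
      moreover have "?m - \<tau> / 2 = node 0 T N (real j)" "?m + \<tau> / 2 = node 0 T N (real (j + 1))"
        by (simp_all add: t_eq algebra_simps)
      moreover have "K * (\<tau> / 2)\<^sup>2 \<le> \<bar>K\<bar> * \<tau>\<^sup>2"
        by (intro mult_mono) (auto simp: power_divide)
      ultimately have quad: "\<bar>f ?x ?m - F\<bar> \<le> \<bar>K\<bar> * \<tau>\<^sup>2" by (simp add: F_def)
      have "\<bar>(w i (Suc j) - \<tau> / 2 * ?A (\<lambda>m. w m (Suc j)) i)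
          - (w i j + \<tau> / 2 * ?A (\<lambda>m. w m j) i + \<tau> * f ?x ?m)\<bar> \<le> C * (\<tau> ^ 3 + \<tau> * h ^ 3)"
        using perturbed i j
        by (simp add: satisfies_perturbed_scheme_def Let_def h_def \<tau>_def w_def)
      moreover have "C * (\<tau> ^ 3 + \<tau> * h ^ 3) \<le> \<bar>C\<bar> * (\<tau> ^ 3 + \<tau> * h ^ 3)"
        using \<tau> h by (intro mult_right_mono) auto
      moreover have "\<bar>\<tau> * (f ?x ?m - F)\<bar> \<le> \<tau> * (\<bar>K\<bar> * \<tau>\<^sup>2)"
        using quad \<tau> by (simp add: abs_mult)
      \<comment> \<open>One factor \<open>\<tau>\<close> is split off; it will later be absorbed by
        the number of time steps.\<close>
      moreover have "\<bar>C\<bar> * (\<tau> ^ 3 + \<tau> * h ^ 3) + \<tau> * (\<bar>K\<bar> * \<tau>\<^sup>2) \<le> \<tau> * (D * (\<tau>\<^sup>2 + h ^ 3))"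
        using \<tau> h by (simp add: D_def algebra_simps power2_eq_square power3_eq_cube)
      ultimately show ?thesis
        using scheme_eq unfolding space_op_diff right_diff_distrib by linarith
    qed
    have "L2_set (\<lambda>i. w i j - U i j) {1..M-1} \<le> real j * (sqrt (real (M - 1)) * (\<tau> * (D * (\<tau>\<^sup>2 + h ^ 3))))"
    proof (rule crank_nicolson_error_bound[where N = N and cl = cl and cr = cr and \<tau> = \<tau>])
      show "weight_symbol \<alpha> lam \<gamma>\<^sub>4 h M x \<le> 0" for x
        using symbol by (simp add: h_def less_imp_le)
      show "j \<le> N" using j by auto
    qed (use assms(6) \<tau> h D boundary initial residual in auto)
    \<comment> \<open>The factor \<open>sqrt h\<close> produces the discrete norm and pairs with
      \<open>sqrt (real (M - 1))\<close>, so the dependence on the number of nodes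
      disappears.\<close>
    then have "sqrt h * L2_set (\<lambda>i. w i j - U i j) {1..M-1}
        \<le> sqrt h * (real j * (sqrt (real (M - 1)) * (\<tau> * (D * (\<tau>\<^sup>2 + h ^ 3)))))"
      using h by (intro mult_left_mono) auto
    also have "\<dots> = (real j * \<tau>) * (sqrt (real (M - 1) * h) * D) * (\<tau>\<^sup>2 + h ^ 3)"
      by (simp add: real_sqrt_mult)
    also have "\<dots> \<le> T * (sqrt (b - a) * D) * (\<tau>\<^sup>2 + h ^ 3)"
    proof -
      have "real j * \<tau> \<le> T"
        using j \<tau> mult_right_mono[of "real j" "real N" \<tau>] by auto
      moreover have "real (M - 1) * h \<le> b - a"
        using h mult_right_mono[of "real (M - 1)" "real M" h] by auto
      ultimately show ?thesis
        using D cD h \<tau> assms(1,2) by (intro mult_mono) (auto intro: less_imp_le)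
    qed
    also have "\<dots> \<le> c * (\<tau>\<^sup>2 + h ^ 3)"
      using h by (intro mult_right_mono) (auto simp: c_def)
    finally show ?thesis
      by (simp add: discrete_L2_norm_def L2_set_def real_sqrt_mult w_def h_def \<tau>_def)
  qed
  ultimately show ?thesis by blast
qed

end
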